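(* Let $\psi\colon\mathcal{K}\times\big((S^1\times S^1)\setminus\Delta\big)\to\mathbb{R}$ be a function, where $\Delta=\{(t,t): t\in S^1\}$. Suppose that $\psi(f,s,\cdot)\,|f'(\cdot)|$ is integrable on $S^1$ for every $f\in\mathcal{K}$ and every $s\in S^1$, and put $$\Psi(f,s)=\int_{S^1}\psi(f,s,t)\,|f'(t)|\,dt.$$ Suppose that $\Psi$ is positive on $\mathcal{K}^\circ\times S^1$ and that $\Psi(f,s)$ is continuous in $s$ for every $f\in\mathcal{K}$. If the $2$-form $\psi(f,s,t)\,|f'(s)|\,|f'(t)|\,ds\,dt$ on $(S^1\times S^1)\setminus\Delta$ is Möbius invariant, i.e. $$\psi(T\circ f,s,t)\,|(T\circ f)'(s)|\,|(T\circ f)'(t)|=\psi(f,s,t)\,|f'(s)|\,|f'(t)|$$ for every $f\in\mathcal{K}$, every $(s,t)\in(S^1\times S^1)\setminus\Delta$ and every Möbius transformation $T$ such that $T(f(S^1))$ is compact, then $$\Psi(T\circ f,s)^3=|T'(f(s))|^{-6}\,\Psi(f,s)^3$$ for every $f\in\mathcal{K}$, every $s\in S^1$ and every Möbius transformation $T$ such that $T(f(S^1))$ is compact.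
   Context: $S^1=\mathbb{R}/\mathbb{Z}$. The space of knots is $\mathcal{K}=\{f\colon S^1\to\mathbb{R}^3 : f \text{ is injective and } |f'(t)|\neq 0 \text{ for all } t\}$, where knots belong to a fixed suitable differentiability class. $\mathcal{K}^\circ\subset\mathcal{K}$ is the set of non-circular knots, i.e. those $f$ for which $f(S^1)$ is not a round circle. A Möbius transformation $T$ is an element of the group of transformations of $\mathbb{R}^3\cup\{\infty\}$ generated by inversions in spheres and reflections in planes. For $p\in\mathbb{R}^3$ with $T(p)\neq\infty$, $|T'(p)|=|\det DT(p)|^{1/6}$, where $DT$ is the Jacobian matrix of $T$. "$T(f(S^1))$ is compact" means $T(f(S^1))\subset\mathbb{R}^3$. *)

theory Defs
  imports "HOL-Analysis.Analysis" "HOL-Algebra.Bij" "HOL-Algebra.Generated_Groups"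
begin

section \<open>The circle \<open>\<real>/\<int>\<close>\<close>

quotient_type circle = real / "\<lambda>x y. x - y \<in> \<int>"
proof (rule equivpI)
  show "reflp (\<lambda>x y :: real. x - y \<in> \<int>)" by (simp add: reflp_def)
  show "symp (\<lambda>x y :: real. x - y \<in> \<int>)"
    by (rule sympI) (use Ints_minus in fastforce)
  show "transp (\<lambda>x y :: real. x - y \<in> \<int>)"
  proof (rule transpI)
    fix x y z :: real assume "x - y \<in> \<int>" "y - z \<in> \<int>"
    then have "(x - y) + (y - z) \<in> \<int>" by (rule Ints_add)
    then show "x - z \<in> \<int>" by simp
  qed
qed

text \<open>The quotient topology.\<close>

instantiation circle :: topological_space
begin

definition open_circle :: "circle set \<Rightarrow> bool" where
  "open_circle U \<longleftrightarrow> open (abs_circle -` U)"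

instance
proof
  show "open (UNIV :: circle set)" by (simp add: open_circle_def)
  show "open (S \<inter> T)" if "open S" "open T" for S T :: "circle set"
    using that by (simp add: open_circle_def open_Int)
  show "open (\<Union>K)" if "\<forall>S\<in>K. open S" for K :: "circle set set"
    using that unfolding open_circle_def vimage_Union by (rule open_UN)
qed

end

lemma continuous_on_abs_circle: "continuous_on UNIV abs_circle"
  unfolding continuous_on_open_vimage[OF open_UNIV] by (simp add: open_circle_def)

text \<open>Lebesgue measure \<open>dt\<close> of total mass 1: the image of Lebesgue measure on the fundamental
  domain \<open>[0,1)\<close>.  Completing makes all Lebesgue measurable integrands admissible, not only the
  Borel ones.\<close>

definition circle_measure :: "circle measure" where
  "circle_measure =
     completion (distr (restrict_space lborel {0..<1}) borel abs_circle)"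

text \<open>The derivative of a map on \<open>\<real>/\<int>\<close> is that of its 1-periodic lift; by periodicity it does not
  depend on the representative of \<open>t\<close>.\<close>

definition circle_deriv :: "(circle \<Rightarrow> 'a::real_normed_vector) \<Rightarrow> circle \<Rightarrow> 'a" where
  "circle_deriv f t = vector_derivative (f \<circ> abs_circle) (at (rep_circle t))"

definition C_k_on_circle :: "enat \<Rightarrow> (circle \<Rightarrow> 'a::real_normed_vector) \<Rightarrow> bool" where
  "C_k_on_circle k f \<longleftrightarrow>
     (\<forall>n. enat n < k \<longrightarrow> (\<forall>x. ((circle_deriv ^^ n) f \<circ> abs_circle) differentiable (at x))) \<and>
     (\<forall>n. enat n \<le> k \<longrightarrow> continuous_on UNIV ((circle_deriv ^^ n) f))"


section \<open>Knots\<close>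

definition knots :: "enat \<Rightarrow> (circle \<Rightarrow> real^3) set" where
  "knots k = {f. C_k_on_circle k f \<and> inj f \<and> (\<forall>t. norm (circle_deriv f t) \<noteq> 0)}"

definition round_circle :: "(real^3) set \<Rightarrow> bool" where
  "round_circle C \<longleftrightarrow>
     (\<exists>c n r. n \<noteq> 0 \<and> r > 0 \<and> C = {x. dist c x = r \<and> n \<bullet> (x - c) = 0})"

definition noncircular_knots :: "enat \<Rightarrow> (circle \<Rightarrow> real^3) set" where
  "noncircular_knots k = {f \<in> knots k. \<not> round_circle (range f)}"


section \<open>Moebius transformations\<close>

text \<open>As in \<open>Alexandroff_extension\<close>, \<open>None\<close> is the point at infinity.\<close>

type_synonym extended_space = "(real^3) option"

definition sphere_inversion :: "real^3 \<Rightarrow> real \<Rightarrow> extended_space \<Rightarrow> extended_space" where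
  "sphere_inversion a r p =
     (case p of
        None \<Rightarrow> Some a
      | Some x \<Rightarrow> if x = a then None else Some (a + (r\<^sup>2 / (norm (x - a))\<^sup>2) *\<^sub>R (x - a)))"

text \<open>Reflection in the plane \<open>n \<bullet> x = c\<close>.\<close>

definition plane_reflection :: "real^3 \<Rightarrow> real \<Rightarrow> extended_space \<Rightarrow> extended_space" where
  "plane_reflection n c = map_option (\<lambda>x. x - (2 * (n \<bullet> x - c) / (n \<bullet> n)) *\<^sub>R n)"

definition moebius_transformations :: "(extended_space \<Rightarrow> extended_space) set" where
  "moebius_transformations =
     generate (BijGroup UNIV)
       ({sphere_inversion a r | a r. r > 0} \<union> {plane_reflection n c | n c. n \<noteq> 0})"

lemma sphere_inversion_involution:
  assumes "r > 0"
  shows "sphere_inversion a r (sphere_inversion a r p) = p"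
proof (cases p)
  case (Some x)
  show ?thesis
  proof (cases "x = a")
    case False
    then have N: "norm (x - a) \<noteq> 0" by simp
    define q where "q = r\<^sup>2 / (norm (x - a))\<^sup>2"
    have q: "q \<noteq> 0" using N assms by (simp add: q_def)
    have "r\<^sup>2 / (norm (q *\<^sub>R (x - a)))\<^sup>2 * q = q * q / (\<bar>q\<bar> * \<bar>q\<bar>)"
      by (simp add: q_def power2_eq_square)
    also have "\<dots> = 1" using q by simp
    finally show ?thesis
      using q False assms by (simp add: Some sphere_inversion_def flip: q_def)
  qed (simp add: Some sphere_inversion_def)
qed (simp add: sphere_inversion_def)

lemma plane_reflection_involution:
  assumes "n \<noteq> 0"
  shows "plane_reflection n c (plane_reflection n c p) = p"
proof (cases p)
  case (Some x)
  define d where "d = 2 * (n \<bullet> x - c) / (n \<bullet> n)"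
  have "d * (n \<bullet> n) = 2 * (n \<bullet> x - c)"
    using assms by (simp add: d_def)
  then have "2 * (n \<bullet> (x - d *\<^sub>R n) - c) = - d * (n \<bullet> n)"
    by (simp add: inner_diff_right)
  then have "2 * (n \<bullet> (x - d *\<^sub>R n) - c) / (n \<bullet> n) = - d"
    using assms by simp
  moreover have "plane_reflection n c (Some y) =
      Some (y - (2 * (n \<bullet> y - c) / (n \<bullet> n)) *\<^sub>R n)" for y
    by (simp add: plane_reflection_def)
  ultimately show ?thesis
    by (simp only: Some flip: d_def) simp
qed (simp add: plane_reflection_def)

lemma generators_in_BijGroup:
  "{sphere_inversion a r | a r. r > 0} \<union> {plane_reflection n c | n c. n \<noteq> 0}
     \<subseteq> carrier (BijGroup UNIV)"
proof -
  have "g \<in> carrier (BijGroup UNIV)" if "\<And>p. g (g p) = p"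
    for g :: "extended_space \<Rightarrow> extended_space"
    using o_bij[of g g] that by (simp add: BijGroup_def Bij_def extensional_def fun_eq_iff)
  then show ?thesis
    using sphere_inversion_involution plane_reflection_involution by blast
qed

text \<open>The map \<open>T \<circ> f\<close>, meaningful if \<open>T\<close> sends no point of the image of \<open>f\<close> to infinity.\<close>

definition transform :: "(extended_space \<Rightarrow> extended_space) \<Rightarrow> (circle \<Rightarrow> real^3) \<Rightarrow> circle \<Rightarrow> real^3"
  where "transform T f = (\<lambda>t. the (T (Some (f t))))"

definition compact_image :: "(extended_space \<Rightarrow> extended_space) \<Rightarrow> (circle \<Rightarrow> real^3) \<Rightarrow> bool" where
  "compact_image T f \<longleftrightarrow> T ` Some ` range f \<subseteq> range Some"

text \<open>The quantity \<open>\<bar>T'(p)\<bar> = \<bar>det DT(p)\<bar>\<^sup>1\<^sup>/\<^sup>6\<close> for \<open>T(p) \<noteq> \<infinity>\<close>, in which case \<open>T\<close> is finite near \<open>p\<close>.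
  It is the square root of the conformal factor of \<open>T\<close> at \<open>p\<close>.\<close>

definition abs_moebius_deriv :: "(extended_space \<Rightarrow> extended_space) \<Rightarrow> real^3 \<Rightarrow> real" where
  "abs_moebius_deriv T p = \<bar>det (jacobian (\<lambda>x. the (T (Some x))) (at p))\<bar> powr (1/6)"


section \<open>Potentials\<close>

text \<open>A function \<open>\<psi>\<close> on knots and pairs of distinct points of the circle is a total function whose
  values on the diagonal are never used; accordingly the domain of integration omits the null
  set \<open>{s}\<close>.\<close>

type_synonym kernel = "(circle \<Rightarrow> real^3) \<Rightarrow> circle \<Rightarrow> circle \<Rightarrow> real"

definition kernel_integrable :: "kernel \<Rightarrow> (circle \<Rightarrow> real^3) \<Rightarrow> circle \<Rightarrow> bool" where
  "kernel_integrable \<psi> f s \<longleftrightarrow>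
     set_integrable circle_measure (- {s}) (\<lambda>t. \<psi> f s t * norm (circle_deriv f t))"

definition potential :: "kernel \<Rightarrow> (circle \<Rightarrow> real^3) \<Rightarrow> circle \<Rightarrow> real" where
  "potential \<psi> f s =
     (LINT t:- {s}|circle_measure. \<psi> f s t * norm (circle_deriv f t))"

definition moebius_invariant_form :: "enat \<Rightarrow> kernel \<Rightarrow> bool" where
  "moebius_invariant_form k \<psi> \<longleftrightarrow>
     (\<forall>f \<in> knots k. \<forall>T \<in> moebius_transformations. \<forall>s t. compact_image T f \<longrightarrow> s \<noteq> t \<longrightarrow>
        \<psi> (transform T f) s t * norm (circle_deriv (transform T f) s)
            * norm (circle_deriv (transform T f) t) =
        \<psi> f s t * norm (circle_deriv f s) * norm (circle_deriv f t))"

end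

theory Submission
  imports Defs
begin

text \<open>
  Integrating the invariance of the form over \<open>t\<close> with \<open>s\<close> fixed gives
  \<open>\<Psi>(T \<circ> f, s) \<bar>(T \<circ> f)'(s)\<bar> = \<Psi>(f, s) \<bar>f'(s)\<bar>\<close>
  (\<open>potential_transform\<close>).  A Moebius transformation \<open>T\<close> is conformal at every point that it does
  not send to infinity: its differential there multiplies all lengths by one factor \<open>c > 0\<close>
  (\<open>moebius_conformal_at\<close>).  So \<open>\<bar>(T \<circ> f)'(s)\<bar> = c \<bar>f'(s)\<bar>\<close>, where \<open>f'(s) \<noteq> 0\<close>, and
  \<open>\<Psi>(T \<circ> f, s) = \<Psi>(f, s) / c\<close>.  In dimension 3 the Jacobian determinant is \<open>\<plusminus>c\<^sup>3\<close>, hence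
  \<open>\<bar>T'(f(s))\<bar> = sqrt c\<close>, and the claim is the cube of the last equation.

  The chain rule along a word in the generators does not prove conformality directly, because a
  partial product may send the point to infinity.  Instead, each \<open>T\<close> distorts distances by
  \<open>\<bar>T x - T y\<bar> = \<mu>(x) \<mu>(y) \<bar>x - y\<bar>\<close>, a relation that extends to the point at infinity and
  is stable under composition (\<open>moebius_distorts\<close>).  If \<open>T\<close> fixes infinity, then it is a
  similarity; otherwise it becomes one when followed by the inversion in the unit sphere centred
  at \<open>T(\<infinity>)\<close>, so it is that inversion after a similarity.
\<close>

section \<open>Distortion of distances\<close>

text \<open>The Euclidean distance, with the point at infinity at distance 1 from every finite point.
  This is not a metric; the value 1 makes the distortion relation below hold at infinity as well.\<close>

definition ext_dist :: "extended_space \<Rightarrow> extended_space \<Rightarrow> real" where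
  "ext_dist p q = (case (p, q) of
      (Some x, Some y) \<Rightarrow> norm (x - y)
    | (None, None) \<Rightarrow> 0
    | _ \<Rightarrow> 1)"

lemma ext_dist_simps [simp]:
  "ext_dist (Some x) (Some y) = norm (x - y)"
  "ext_dist None None = 0"
  "ext_dist (Some x) None = 1"
  "ext_dist None (Some x) = 1"
  by (simp_all add: ext_dist_def)

text \<open>The map \<open>T\<close> multiplies distances by a product of positive weights of the two points.\<close>

definition distorts_by :: "(extended_space \<Rightarrow> extended_space) \<Rightarrow> (extended_space \<Rightarrow> real) \<Rightarrow> bool"
  where "distorts_by T \<mu> \<longleftrightarrow>
    (\<forall>p. \<mu> p > 0) \<and> (\<forall>p q. ext_dist (T p) (T q) = \<mu> p * \<mu> q * ext_dist p q)"

lemma distorts_by_compose: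
  assumes "distorts_by S \<mu>" "distorts_by T \<nu>"
  shows "distorts_by (S \<circ> T) (\<lambda>p. \<mu> (T p) * \<nu> p)"
  using assms by (simp add: distorts_by_def)

text \<open>How the inversion in the unit sphere centred at 0 changes distances.\<close>

lemma norm_inversion_diff:
  fixes u v :: "'a::real_inner"
  assumes "u \<noteq> 0" "v \<noteq> 0"
  shows "norm (u /\<^sub>R (norm u)\<^sup>2 - v /\<^sub>R (norm v)\<^sup>2) = norm (u - v) / (norm u * norm v)"
proof -
  have "(norm (u /\<^sub>R (norm u)\<^sup>2 - v /\<^sub>R (norm v)\<^sup>2))\<^sup>2 = (norm (u - v) / (norm u * norm v))\<^sup>2"
    using assms
    by (simp add: power_divide power_mult_distrib power2_norm_eq_inner
        inner_diff_left inner_diff_right inner_commute field_simps)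
  then show ?thesis
    by (rule power2_eq_imp_eq) simp_all
qed

lemma distorts_by_sphere_inversion:
  assumes "r > 0"
  shows "distorts_by (sphere_inversion a r)
    (\<lambda>p. case p of None \<Rightarrow> r | Some x \<Rightarrow> if x = a then 1 / r else r / norm (x - a))"
proof -
  have *: "norm ((r\<^sup>2 / (norm (x - a))\<^sup>2) *\<^sub>R (x - a) - (r\<^sup>2 / (norm (y - a))\<^sup>2) *\<^sub>R (y - a)) =
        r / norm (x - a) * (r / norm (y - a)) * norm (x - y)"
    if "x \<noteq> a" "y \<noteq> a" for x y
  proof -
    have "(r\<^sup>2 / (norm (x - a))\<^sup>2) *\<^sub>R (x - a) - (r\<^sup>2 / (norm (y - a))\<^sup>2) *\<^sub>R (y - a) =
        r\<^sup>2 *\<^sub>R ((x - a) /\<^sub>R (norm (x - a))\<^sup>2 - (y - a) /\<^sub>R (norm (y - a))\<^sup>2)"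
      by (simp add: scaleR_diff_right divide_inverse)
    then show ?thesis
      using norm_inversion_diff[of "x - a" "y - a"] that
      by (simp add: power2_eq_square)
  qed
  have "norm ((r\<^sup>2 / (norm (x - a))\<^sup>2) *\<^sub>R (x - a)) = r * (r / norm (x - a))" if "x \<noteq> a" for x
    using that by (simp add: power2_eq_square)
  with * show ?thesis
    using assms
    by (auto simp: distorts_by_def sphere_inversion_def norm_minus_commute split: option.split)
qed

lemma distorts_by_plane_reflection:
  assumes "n \<noteq> 0"
  shows "distorts_by (plane_reflection n c) (\<lambda>_. 1)"
proof -
  have "norm (x - (2 * (n \<bullet> x - c) / (n \<bullet> n)) *\<^sub>R n - (y - (2 * (n \<bullet> y - c) / (n \<bullet> n)) *\<^sub>R n))
      = norm (x - y)" for x y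
  proof -
    define d where "d = 2 * (n \<bullet> (x - y)) / (n \<bullet> n)"
    have d: "d * (n \<bullet> n) = 2 * (n \<bullet> (x - y))"
      using assms by (simp add: d_def)
    have "x - (2 * (n \<bullet> x - c) / (n \<bullet> n)) *\<^sub>R n - (y - (2 * (n \<bullet> y - c) / (n \<bullet> n)) *\<^sub>R n)
        = (x - y) - d *\<^sub>R n"
      by (simp add: d_def inner_diff_right diff_divide_distrib right_diff_distrib
          scaleR_diff_left)
    moreover have "(norm ((x - y) - d *\<^sub>R n))\<^sup>2 =
        (norm (x - y))\<^sup>2 - d * (2 * (n \<bullet> (x - y))) + d * (d * (n \<bullet> n))"
      unfolding power2_norm_eq_inner
      by (simp add: inner_diff_left inner_diff_right inner_commute algebra_simps)
    moreover have "(norm ((x - y) - d *\<^sub>R n))\<^sup>2 = (norm (x - y))\<^sup>2"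
      using calculation(2) unfolding d by simp
    then have "norm ((x - y) - d *\<^sub>R n) = norm (x - y)"
      by (rule power2_eq_imp_eq) simp_all
    ultimately show ?thesis
      by (simp only:)
  qed
  then show ?thesis
    unfolding distorts_by_def plane_reflection_def ext_dist_def
    by (simp split: option.split)
qed

lemma moebius_distorts:
  assumes "T \<in> moebius_transformations"
  shows "\<exists>\<mu>. distorts_by T \<mu>"
  using assms unfolding moebius_transformations_def
proof (induction rule: generate.induct)
  case one
  have "distorts_by (\<lambda>p. p) (\<lambda>_. 1)"
    by (simp add: distorts_by_def)
  then show ?case
    by (auto simp: BijGroup_def)
next
  case (incl h)
  then show ?case
    using distorts_by_sphere_inversion distorts_by_plane_reflection by blast
next
  case (inv h)
  \<comment> \<open>Each generator is its own inverse.\<close>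
  have "h p = q \<longleftrightarrow> p = h q" for p q
    using inv sphere_inversion_involution plane_reflection_involution by auto
  then have "inv_into UNIV h p = h p" for p
    by (metis inv_unique_comp comp_def id_def ext)
  moreover have "h \<in> Bij UNIV"
    using subsetD[OF generators_in_BijGroup inv] by (simp add: BijGroup_def)
  ultimately have "inv\<^bsub>BijGroup UNIV\<^esub> h = h"
    by (simp add: inv_BijGroup fun_eq_iff)
  moreover have "\<exists>\<mu>. distorts_by h \<mu>"
    using inv distorts_by_sphere_inversion distorts_by_plane_reflection by blast
  ultimately show ?case
    by simp
next
  case (eng g h)
  have "g \<in> Bij UNIV" "h \<in> Bij UNIV"
    using eng.hyps[THEN group.generate_in_carrier[OF group_BijGroup generators_in_BijGroup]]
    by (simp_all add: BijGroup_def)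
  then have "g \<otimes>\<^bsub>BijGroup UNIV\<^esub> h = g \<circ> h"
    by (simp add: BijGroup_def compose_def fun_eq_iff)
  moreover obtain \<mu> \<nu> where "distorts_by g \<mu>" "distorts_by h \<nu>"
    using eng.IH by blast
  then have "distorts_by (g \<circ> h) (\<lambda>p. \<mu> (h p) * \<nu> p)"
    by (rule distorts_by_compose)
  ultimately show ?case
    by (auto simp: comp_def)
qed

section \<open>Conformality\<close>

text \<open>The map \<open>g\<close> is differentiable at \<open>p\<close>, and its differential multiplies lengths by \<open>c > 0\<close>;
  preservation of orientation is not required.\<close>

definition conformal_at :: "(real^3 \<Rightarrow> real^3) \<Rightarrow> real \<Rightarrow> real^3 \<Rightarrow> bool" where
  "conformal_at g c p \<longleftrightarrow>
    c > 0 \<and> (\<exists>L. (g has_derivative L) (at p) \<and> (\<forall>h. norm (L h) = c * norm h))"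

lemma conformal_at_compose:
  assumes "conformal_at g c p" "conformal_at j d (g p)"
  shows "conformal_at (j \<circ> g) (d * c) p"
proof -
  obtain K L where "(g has_derivative K) (at p)" "\<And>h. norm (K h) = c * norm h"
    and "(j has_derivative L) (at (g p))" "\<And>h. norm (L h) = d * norm h"
    using assms by (auto simp: conformal_at_def)
  then have "(j \<circ> g has_derivative L \<circ> K) (at p)" "\<And>h. norm ((L \<circ> K) h) = d * c * norm h"
    by (auto intro: diff_chain_at)
  then show ?thesis
    using assms unfolding conformal_at_def by (meson mult_pos_pos)
qed

text \<open>The inversion in the unit sphere centred at \<open>b\<close>.  With \<open>w = p - b\<close>, its differential at \<open>p\<close>
  is the reflection in the plane orthogonal to \<open>w\<close>, divided by \<open>\<bar>w\<bar>\<^sup>2\<close>.\<close>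

lemma conformal_at_inversion:
  assumes "p \<noteq> b"
  shows "conformal_at (\<lambda>y. b + (y - b) /\<^sub>R (norm (y - b))\<^sup>2) (1 / (norm (p - b))\<^sup>2) p"
proof -
  define w where "w = p - b"
  have w: "w \<noteq> 0" "w \<bullet> w \<noteq> 0" using assms by (simp_all add: w_def)
  define L where "L h = h /\<^sub>R (w \<bullet> w) - (2 * (w \<bullet> h) / (w \<bullet> w)\<^sup>2) *\<^sub>R w" for h
  have "((\<lambda>y. b + (y - b) /\<^sub>R ((y - b) \<bullet> (y - b))) has_derivative L) (at p)"
    unfolding L_def w_def
    using assms
    by (auto intro!: derivative_eq_intros
        simp: fun_eq_iff power2_eq_square inner_commute divide_inverse)
  moreover have "norm (L h) = 1 / (norm w)\<^sup>2 * norm h" for h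
  proof -
    have "L h \<bullet> L h = (h \<bullet> h) / (w \<bullet> w)\<^sup>2"
      using w unfolding L_def
      by (simp add: inner_diff_left inner_diff_right inner_commute field_simps power2_eq_square)
    then have "(norm (L h))\<^sup>2 = (1 / (norm w)\<^sup>2 * norm h)\<^sup>2"
      by (simp only: power_mult_distrib power_divide power2_norm_eq_inner) simp
    then show ?thesis
      by (rule power2_eq_imp_eq) simp_all
  qed
  ultimately show ?thesis
    using w by (auto simp: conformal_at_def power2_norm_eq_inner w_def)
qed

lemma similarity_conformal_at:
  fixes g :: "real^3 \<Rightarrow> real^3"
  assumes "c > 0" and sim: "\<And>x y. norm (g x - g y) = c * norm (x - y)"
  shows "conformal_at g c p"
proof -
  \<comment> \<open>Subtracting \<open>g 0\<close> and rescaling gives an isometry that fixes 0, which is linear.\<close>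
  define A where "A x = (g x - g 0) /\<^sub>R c" for x
  have "A 0 = 0" by (simp add: A_def)
  moreover have "dist (A x) (A y) = dist x y" for x y
  proof -
    have "A x - A y = (g x - g y) /\<^sub>R c"
      by (simp add: A_def flip: scaleR_diff_right)
    then show ?thesis
      using \<open>c > 0\<close> by (simp add: dist_norm sim)
  qed
  ultimately have A: "orthogonal_transformation A"
    by (simp add: orthogonal_transformation_isometry)
  have "g = (\<lambda>x. g 0 + c *\<^sub>R A x)"
    using \<open>c > 0\<close> by (simp add: A_def fun_eq_iff)
  moreover have "((\<lambda>x. g 0 + c *\<^sub>R A x) has_derivative (\<lambda>x. c *\<^sub>R A x)) (at p)"
    using A by (auto intro!: derivative_eq_intros linear_imp_has_derivative
        simp: orthogonal_transformation_def)
  moreover have "norm (c *\<^sub>R A h) = c * norm h" for h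
    using A \<open>c > 0\<close> by (simp add: orthogonal_transformation_norm)
  ultimately show ?thesis
    using \<open>c > 0\<close> unfolding conformal_at_def by metis
qed

text \<open>A distorting map that fixes infinity is a similarity: the relation between a finite point and
  infinity forces \<open>\<mu>\<close> to be constant on the finite points.\<close>

lemma distorting_fixes_infinity:
  assumes "distorts_by S \<mu>" "S None = None"
  obtains c g where "c > 0" "\<And>x. S (Some x) = Some (g x)"
    "\<And>x y. norm (g x - g y) = c * norm (x - y)"
proof -
  have pos: "\<mu> p > 0" and D: "ext_dist (S p) (S q) = \<mu> p * \<mu> q * ext_dist p q" for p q
    using assms(1) by (auto simp: distorts_by_def)
  define g where "g x = the (S (Some x))" for x
  have g: "S (Some x) = Some (g x)" for x
  proof (cases "S (Some x)")
    case None
    with D[of "Some x" None] pos[of "Some x"] pos[of None] assms(2) show ?thesis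
      by simp
  qed (simp add: g_def)
  have \<mu>: "\<mu> (Some x) = 1 / \<mu> None" for x
    using D[of "Some x" None] g[of x] assms(2) pos[of None] by (simp add: field_simps)
  show thesis
  proof (rule that[of "1 / (\<mu> None)\<^sup>2" g])
    show "norm (g x - g y) = 1 / (\<mu> None)\<^sup>2 * norm (x - y)" for x y
      using D[of "Some x" "Some y"] by (simp add: g \<mu> power2_eq_square)
  qed (use g pos[of None] in auto)
qed

lemma moebius_conformal_at:
  assumes "T \<in> moebius_transformations" "T (Some p) \<noteq> None"
  shows "\<exists>c. conformal_at (\<lambda>x. the (T (Some x))) c p"
proof -
  obtain \<mu> where \<mu>: "distorts_by T \<mu>"
    using moebius_distorts[OF assms(1)] ..
  show ?thesis
  proof (cases "T None")
    case None
    obtain c g where g: "c > 0" "\<And>x. T (Some x) = Some (g x)"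
      "\<And>x y. norm (g x - g y) = c * norm (x - y)"
      using distorting_fixes_infinity[OF \<mu> None] by blast
    have "conformal_at (\<lambda>x. the (T (Some x))) c p"
      using similarity_conformal_at[OF g(1,3)] by (simp add: g(2))
    then show ?thesis ..
  next
    case (Some b)
    \<comment> \<open>\<open>J\<close> sends \<open>b = T(\<infinity>)\<close> back to infinity, so \<open>J \<circ> T\<close> is a similarity \<open>g\<close>, and \<open>T = J \<circ> g\<close>.\<close>
    define J where "J = sphere_inversion b 1"
    have "distorts_by (J \<circ> T) (\<lambda>q. (case T q of None \<Rightarrow> 1 | Some x \<Rightarrow>
        if x = b then 1 / 1 else 1 / norm (x - b)) * \<mu> q)"
      unfolding J_def by (rule distorts_by_compose[OF distorts_by_sphere_inversion \<mu>]) simp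
    moreover have "(J \<circ> T) None = None"
      by (simp add: Some J_def sphere_inversion_def)
    ultimately obtain c g where g: "c > 0" "\<And>x. (J \<circ> T) (Some x) = Some (g x)"
      "\<And>x y. norm (g x - g y) = c * norm (x - y)"
      using distorting_fixes_infinity by blast
    have T: "T (Some x) = J (Some (g x))" for x
      using g(2)[of x] sphere_inversion_involution[of 1 b "T (Some x)"]
      by (simp add: J_def)
    have "g p \<noteq> b"
      using assms(2) T[of p] by (auto simp: J_def sphere_inversion_def)
    \<comment> \<open>The finite part of \<open>J\<close>; they agree away from \<open>b\<close>, hence near \<open>g p\<close>.\<close>
    define j where "j y = b + (y - b) /\<^sub>R (norm (y - b))\<^sup>2" for y
    have conf: "conformal_at (j \<circ> g) (1 / (norm (g p - b))\<^sup>2 * c) p"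
      unfolding j_def
      by (rule conformal_at_compose[OF similarity_conformal_at[OF g(1,3)]
            conformal_at_inversion[OF \<open>g p \<noteq> b\<close>]])
    have "isCont g p"
      using similarity_conformal_at[OF g(1,3), of p]
      by (auto simp: conformal_at_def intro: has_derivative_continuous)
    then have "\<forall>\<^sub>F x in nhds p. g x \<noteq> b"
      using \<open>g p \<noteq> b\<close> by (simp add: isCont_def tendsto_at_iff_tendsto_nhds tendsto_imp_eventually_ne)
    then have eq: "\<forall>\<^sub>F x in nhds p. (j \<circ> g) x = the (T (Some x))"
      by eventually_elim (simp add: T J_def j_def sphere_inversion_def divide_inverse)
    have "((\<lambda>x. the (T (Some x))) has_derivative L) (at p)"
      if "((j \<circ> g) has_derivative L) (at p)" for L
    proof (rule has_derivative_transform_eventually[OF that])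
      show "\<forall>\<^sub>F x in at p. (j \<circ> g) x = the (T (Some x))"
        using eq by (simp add: eventually_nhds_conv_at)
      show "(j \<circ> g) p = the (T (Some p))"
        using eq by (rule eventually_nhds_x_imp_x)
    qed simp
    with conf show ?thesis
      unfolding conformal_at_def by blast
  qed
qed

section \<open>Jacobian determinants and derivatives of knots\<close>

lemma conformal_at_det_jacobian:
  assumes "conformal_at g c p"
  shows "\<bar>det (jacobian g (at p))\<bar> = c ^ 3"
proof -
  obtain L where c: "c > 0" and L: "(g has_derivative L) (at p)"
    and norm: "\<And>h. norm (L h) = c * norm h"
    using assms by (auto simp: conformal_at_def)
  have lin: "linear L"
    using L by (rule has_derivative_linear)
  have "orthogonal_transformation (\<lambda>h. (1 / c) *\<^sub>R L h)"
    using c lin by (simp add: orthogonal_transformation norm linear_compose_scale_right)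
  then have "\<bar>det (matrix (\<lambda>h. (1 / c) *\<^sub>R L h))\<bar> = 1"
    by (rule orthogonal_transformation_det)
  moreover have "matrix L = matrix ((*\<^sub>R) c) ** matrix (\<lambda>h. (1 / c) *\<^sub>R L h)"
    using c lin matrix_compose[of "\<lambda>h. (1 / c) *\<^sub>R L h" "(*\<^sub>R) c"]
    by (simp add: comp_def linear_compose_scale_right linear_scaleR)
  ultimately have "\<bar>det (matrix L)\<bar> = c ^ 3"
    using c by (simp add: det_mul abs_mult power_abs)
  then show ?thesis
    by (simp add: jacobian_def frechet_derivative_at[OF L, symmetric])
qed

lemma abs_moebius_deriv_conformal:
  assumes "conformal_at (\<lambda>x. the (T (Some x))) c p"
  shows "abs_moebius_deriv T p = sqrt c"
proof -
  have "c > 0" using assms by (simp add: conformal_at_def)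
  then have "(c ^ 3) powr (1/6) = sqrt c"
    by (simp add: powr_powr powr_half_sqrt flip: powr_numeral)
  then show ?thesis
    by (simp add: abs_moebius_deriv_def conformal_at_det_jacobian[OF assms])
qed

lemma norm_circle_deriv_transform:
  assumes "(f \<circ> abs_circle) differentiable (at (rep_circle s))"
    and "conformal_at (\<lambda>x. the (T (Some x))) c (f s)"
  shows "norm (circle_deriv (transform T f) s) = c * norm (circle_deriv f s)"
proof -
  let ?t = "rep_circle s"
  obtain L where L: "((\<lambda>x. the (T (Some x))) has_derivative L) (at (f s))"
    and norm: "\<And>h. norm (L h) = c * norm h"
    using assms(2) by (auto simp: conformal_at_def)
  have "abs_circle ?t = s"
    by (rule Quotient3_abs_rep[OF Quotient3_circle])
  then have L': "((\<lambda>x. the (T (Some x))) has_derivative L) (at ((f \<circ> abs_circle) ?t))"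
    using L by simp
  have "((f \<circ> abs_circle) has_derivative (\<lambda>h. h *\<^sub>R circle_deriv f s)) (at ?t)"
    using assms(1) by (simp add: circle_deriv_def vector_derivative_works
        flip: has_vector_derivative_def)
  from diff_chain_at[OF this L'] has_derivative_linear[OF L]
  have "((transform T f \<circ> abs_circle) has_vector_derivative L (circle_deriv f s)) (at ?t)"
    by (simp add: has_vector_derivative_def transform_def comp_def linear_scale)
  then show ?thesis
    by (simp add: circle_deriv_def vector_derivative_at norm)
qed

section \<open>Transformation of the potential\<close>

lemma potential_transform:
  assumes "moebius_invariant_form k \<psi>" "f \<in> knots k" "T \<in> moebius_transformations"
    "compact_image T f"
  shows "potential \<psi> (transform T f) s * norm (circle_deriv (transform T f) s) =
    potential \<psi> f s * norm (circle_deriv f s)"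
proof -
  have "indicator (- {s}) t *\<^sub>R (\<psi> (transform T f) s t * norm (circle_deriv (transform T f) t))
          * norm (circle_deriv (transform T f) s) =
        indicator (- {s}) t *\<^sub>R (\<psi> f s t * norm (circle_deriv f t)) * norm (circle_deriv f s)" for t
    using assms unfolding moebius_invariant_form_def
    by (cases "s = t") (simp_all add: mult_ac)
  \<comment> \<open>Constant factors move out of an integral of reals even without integrability, since the
    default value is 0.\<close>
  then show ?thesis
    unfolding potential_def set_lebesgue_integral_def integral_mult_left_zero[symmetric]
    by (simp only:)
qed

theorem theorem4p1:
  fixes k :: enat and \<psi> :: kernel
  assumes "k \<ge> 1"
    and "\<forall>f \<in> knots k. \<forall>s. kernel_integrable \<psi> f s"
    and "\<forall>f \<in> noncircular_knots k. \<forall>s. potential \<psi> f s > 0"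
    and "\<forall>f \<in> knots k. continuous_on UNIV (potential \<psi> f)"
    and "moebius_invariant_form k \<psi>"
  shows "\<forall>f \<in> knots k. \<forall>s. \<forall>T \<in> moebius_transformations. compact_image T f \<longrightarrow>
           potential \<psi> (transform T f) s ^ 3 =
             abs_moebius_deriv T (f s) powi (- 6) * potential \<psi> f s ^ 3"
proof (intro ballI allI impI)
  fix f s T
  assume f: "f \<in> knots k" and T: "T \<in> moebius_transformations" and fin: "compact_image T f"
  have "T (Some (f s)) \<noteq> None"
    using fin by (auto simp: compact_image_def image_subset_iff)
  then obtain c where conf: "conformal_at (\<lambda>x. the (T (Some x))) c (f s)"
    using moebius_conformal_at[OF T] by blast
  then have c: "c > 0" by (simp add: conformal_at_def)
  have "enat 0 < k"
    using assms(1) by (metis enat_0 less_le_trans zero_less_one)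
  then have "(f \<circ> abs_circle) differentiable (at (rep_circle s))"
    using f by (force simp: knots_def C_k_on_circle_def)
  from norm_circle_deriv_transform[OF this conf] potential_transform[OF assms(5) f T fin, of s]
  have "potential \<psi> (transform T f) s * c * norm (circle_deriv f s)
      = potential \<psi> f s * norm (circle_deriv f s)"
    by (simp add: mult_ac)
  moreover have "norm (circle_deriv f s) \<noteq> 0"
    using f by (simp add: knots_def)
  ultimately have "potential \<psi> (transform T f) s = potential \<psi> f s / c"
    using c by (simp add: field_simps)
  moreover have "sqrt c powi (- 6) = 1 / c ^ 3"
  proof -
    have "sqrt c ^ 6 = ((sqrt c)\<^sup>2) ^ 3"
      by (simp flip: power_mult)
    then show ?thesis
      using c by (simp add: power_int_def divide_inverse power_inverse)
  qed
  ultimately show "potential \<psi> (transform T f) s ^ 3 =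
      abs_moebius_deriv T (f s) powi (- 6) * potential \<psi> f s ^ 3"
    by (simp add: abs_moebius_deriv_conformal[OF conf] power_divide)
qed

end
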